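(* For every $n\in\mathbb{N}$, the map $\overline{n}:\overline{\alpha}\mapsto\overline{n\alpha}$ maps $ESP^+$ to $ESP^+$. In particular, for all $q\in\mathbb{Q}_{>0}$ and all $\overline{\alpha}\in ESP^+$, we have $\overline{q\alpha}\in ESP^+$.
   Context: $\overline{\alpha}=[a_0;a_1,a_2,\dots]$ denotes the continued fraction expansion of a real number $\alpha$ ($a_0\in\mathbb{Z}$, $a_i\in\mathbb{N}$ for $i\ge1$). A bar over a block of partial quotients denotes infinite repetition. A continued fraction is essentially periodic if it has the form $[a_0;\overline{a_1,\dots,a_s}]$ with $a_0\le a_s$, or $[0;a_1,\overline{a_2,\dots,a_{s+1}}]$ with $a_1\le a_{s+1}$. $ESP^+$ is the set of essentially periodic continued fractions representing positive numbers. *)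

theory Defs
  imports Complex_Main
begin

text \<open>
  A continued fraction \<open>[a\<^sub>0; a\<^sub>1, a\<^sub>2, \<dots>]\<close> is represented by its sequence of partial quotients.
  A terminating one (the expansion of a rational number) is padded with zeros. This is
  unambiguous, as genuine partial quotients of positive index are at least 1, and it agrees with
  the convention \<open>1 / 0 = 0\<close> in both directions: once a complete quotient is an integer, all later
  ones are 0, and a tail of zeros contributes nothing to the value.
\<close>

type_synonym cfrac = "nat \<Rightarrow> int"

definition cf_expansion :: "real \<Rightarrow> cfrac" where
  "cf_expansion \<alpha> k = \<lfloor>((\<lambda>x. 1 / (x - of_int \<lfloor>x\<rfloor>)) ^^ k) \<alpha>\<rfloor>"

fun cf_convergent :: "cfrac \<Rightarrow> nat \<Rightarrow> real" where
  "cf_convergent a 0 = of_int (a 0)"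
| "cf_convergent a (Suc n) = of_int (a 0) + 1 / cf_convergent (\<lambda>k. a (Suc k)) n"

definition cf_value :: "cfrac \<Rightarrow> real" where
  "cf_value a = lim (cf_convergent a)"

definition infinite_cf :: "cfrac \<Rightarrow> bool" where
  "infinite_cf a \<longleftrightarrow> (\<forall>k\<ge>1. a k \<ge> 1)"

text \<open>
  The two disjuncts are the shapes \<open>[a\<^sub>0; a\<^sub>1, \<dots>, a\<^sub>s, a\<^sub>1, \<dots>, a\<^sub>s, \<dots>]\<close> with \<open>a\<^sub>0 \<le> a\<^sub>s\<close>, and
  \<open>[0; a\<^sub>1, a\<^sub>2, \<dots>, a\<^bsub>s+1\<^esub>, a\<^sub>2, \<dots>, a\<^bsub>s+1\<^esub>, \<dots>]\<close> with \<open>a\<^sub>1 \<le> a\<^bsub>s+1\<^esub>\<close>. The period \<open>s\<close> need not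
  be minimal.
\<close>

definition essentially_periodic :: "cfrac \<Rightarrow> bool" where
  "essentially_periodic a \<longleftrightarrow> infinite_cf a \<and>
     ((\<exists>s\<ge>1. (\<forall>k\<ge>1. a (k + s) = a k) \<and> a 0 \<le> a s) \<or>
      (\<exists>s\<ge>1. a 0 = 0 \<and> (\<forall>k\<ge>2. a (k + s) = a k) \<and> a 1 \<le> a (s + 1)))"

definition ESP_plus :: "cfrac set" where
  "ESP_plus = {a. essentially_periodic a \<and> cf_value a > 0}"

definition cf_mult :: "nat \<Rightarrow> cfrac \<Rightarrow> cfrac" where
  "cf_mult n a = cf_expansion (real n * cf_value a)"

end

theory Submission
  imports Defs
begin

text \<open>
  The expansions in \<open>ESP_plus\<close> are exactly those of the quadratic irrationals \<open>x > 0\<close> with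
  negative conjugate \<open>y\<close>, i.e. of the irrational positive roots of integer polynomials
  \<open>A X\<^sup>2 + B X + C\<close> with \<open>A > 0 > C\<close>; this class is visibly closed under multiplication by
  positive rationals. The characterization refines Galois' theorem on purely periodic continued
  fractions. Running the continued fraction algorithm on the pair \<open>(x, y)\<close> preserves the
  discriminant, so the orbit is finite; and the algorithm is injective on pairs with
  \<open>-1 < y < 0\<close>, because the partial quotient can be read off from the image of \<open>y\<close>.
  Hence the orbit is periodic from the first such pair on.
\<close>

section \<open>Convergence of continued fractions\<close>

lemma cf_convergent_bounds:
  assumes "\<And>k. k \<ge> 1 \<Longrightarrow> a k \<ge> 1"
  shows "of_int (a 0) \<le> cf_convergent a n" "cf_convergent a n \<le> of_int (a 0) + 1"
proof -
  have "of_int (a 0) \<le> cf_convergent a n \<and> cf_convergent a n \<le> of_int (a 0) + 1"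
    using assms
  proof (induction n arbitrary: a)
    case (Suc n)
    have "of_int (a 1) \<le> cf_convergent (\<lambda>k. a (Suc k)) n"
      using Suc.IH[of "\<lambda>k. a (Suc k)"] Suc.prems by simp
    moreover have "(1::real) \<le> of_int (a 1)"
      using Suc.prems[of 1] by simp
    ultimately show ?case by simp
  qed simp
  then show "of_int (a 0) \<le> cf_convergent a n" "cf_convergent a n \<le> of_int (a 0) + 1"
    by auto
qed

text \<open>A single step from \<open>t\<close> to \<open>a + 1 / t\<close> has no uniform
  contraction factor for \<open>t\<close> near 1, but two steps do: \<open>1 / u - 1 / v\<close> is
  \<open>(u' - v')\<close> divided by \<open>(u * u') * (v * v')\<close>, and
  \<open>u * u' = a * u' + 1\<close> is at least 2, likewise for \<open>v\<close>.\<close>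

lemma inverse_step_contraction:
  fixes u v u' v' :: real and a :: int
  assumes "a \<ge> 1" "u' \<ge> 1" "v' \<ge> 1" "u = a + 1 / u'" "v = a + 1 / v'"
  shows "\<bar>1 / u - 1 / v\<bar> \<le> \<bar>u' - v'\<bar> / 4"
proof -
  have a: "(1::real) \<le> a" using assms(1) by simp
  have u: "u * u' = a * u' + 1" and v: "v * v' = a * v' + 1"
    using assms by (simp_all add: field_simps)
  have "1 * 1 \<le> a * u'" "1 * 1 \<le> a * v'"
    using a assms by (intro mult_mono; simp)+
  then have u2: "u * u' \<ge> 2" and v2: "v * v' \<ge> 2"
    using u v by auto
  have pos: "u > 0" "v > 0" using assms a by (auto intro!: add_pos_pos)
  define d where "d = (u * u') * (v * v')"
  have "1 / u - 1 / v = (v - u) / (u * v)"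
    using pos by (simp add: field_simps)
  also have "v - u = (u' - v') / (u' * v')"
    unfolding assms(4,5) using assms(2,3) by (simp add: field_simps)
  finally have "1 / u - 1 / v = (u' - v') / d"
    by (simp add: d_def mult_ac)
  moreover have "2 * 2 \<le> d"
    unfolding d_def using u2 v2 by (intro mult_mono) auto
  ultimately show ?thesis
    using frac_le[of "\<bar>u' - v'\<bar>" "\<bar>u' - v'\<bar>" 4 d] by (simp add: abs_divide)
qed

text \<open>All convergents lie in an interval of length 1, and every two partial quotients peeled
  off the front gain a factor 1/4.\<close>

lemma cf_convergent_dist:
  assumes "\<And>k. k \<ge> 1 \<Longrightarrow> a k \<ge> 1" "n \<ge> 2 * j" "m \<ge> 2 * j"
  shows "\<bar>cf_convergent a n - cf_convergent a m\<bar> \<le> (1/4) ^ j"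
  using assms
proof (induction j arbitrary: a n m)
  case 0
  then show ?case
    using cf_convergent_bounds[of a n] cf_convergent_bounds[of a m] by auto
next
  case (Suc j)
  obtain n' m' where nm: "n = Suc (Suc n')" "m = Suc (Suc m')" "n' \<ge> 2 * j" "m' \<ge> 2 * j"
    using Suc.prems(2,3) by (metis add_2_eq_Suc le_Suc_ex add.assoc le_add1 mult_Suc_right)
  let ?b = "\<lambda>k. a (Suc (Suc k))"
  have 1: "cf_convergent ?b i \<ge> 1" for i
  proof -
    have "(1::real) \<le> of_int (?b 0)" using Suc.prems(1)[of 2] by (simp add: numeral_2_eq_2)
    also have "\<dots> \<le> cf_convergent ?b i"
      by (rule cf_convergent_bounds) (use Suc.prems(1) in auto)
    finally show ?thesis .
  qed
  have "\<bar>cf_convergent a n - cf_convergent a m\<bar> \<le> \<bar>cf_convergent ?b n' - cf_convergent ?b m'\<bar> / 4"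
    using inverse_step_contraction[OF _ 1 1 refl refl, of "a 1" n' m'] Suc.prems(1)[of 1]
    by (simp add: nm)
  also have "\<dots> \<le> (1/4) ^ j / 4"
    using Suc.IH[of ?b n' m'] Suc.prems(1) nm by simp
  finally show ?case by simp
qed

lemma convergent_cf_convergent:
  assumes "\<And>k. k \<ge> 1 \<Longrightarrow> a k \<ge> 1"
  shows "convergent (cf_convergent a)"
proof (rule Cauchy_convergent, rule metric_CauchyI)
  fix e :: real assume "e > 0"
  then obtain j where "(1/4) ^ j < e"
    using real_arch_pow_inv[of e "1/4"] by auto
  then show "\<exists>M. \<forall>m\<ge>M. \<forall>n\<ge>M. dist (cf_convergent a m) (cf_convergent a n) < e"
    using cf_convergent_dist[OF assms] by (intro exI[of _ "2 * j"]) (fastforce simp: dist_real_def)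
qed

lemma cf_value_ge:
  assumes "\<And>k. k \<ge> 1 \<Longrightarrow> a k \<ge> 1"
  shows "of_int (a 0) \<le> cf_value a"
proof -
  have "cf_convergent a \<longlonglongrightarrow> cf_value a"
    using convergent_cf_convergent[OF assms] by (simp add: cf_value_def convergent_LIMSEQ_iff)
  then show ?thesis
    by (rule LIMSEQ_le_const) (auto intro!: cf_convergent_bounds(1) assms)
qed

lemma cf_value_rec:
  assumes "\<And>k. k \<ge> 1 \<Longrightarrow> a k \<ge> 1"
  shows "cf_value a = of_int (a 0) + 1 / cf_value (\<lambda>k. a (Suc k))"
proof -
  let ?b = "\<lambda>k. a (Suc k)"
  have la: "cf_convergent a \<longlonglongrightarrow> cf_value a"
    using convergent_cf_convergent[OF assms] by (simp add: cf_value_def convergent_LIMSEQ_iff)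
  have lb: "cf_convergent ?b \<longlonglongrightarrow> cf_value ?b"
    using convergent_cf_convergent[of ?b] assms by (simp add: cf_value_def convergent_LIMSEQ_iff)
  have "of_int (a 1) \<le> cf_value ?b"
    using cf_value_ge[of ?b] assms by simp
  moreover have "a 1 \<ge> 1" using assms by simp
  \<comment> \<open>The reciprocal is continuous at the limit only because that limit is
    nonzero.\<close>
  ultimately have "cf_value ?b \<noteq> 0" by linarith
  then have "(\<lambda>n. of_int (a 0) + 1 / cf_convergent ?b n) \<longlonglongrightarrow> of_int (a 0) + 1 / cf_value ?b"
    by (intro tendsto_intros lb)
  moreover have "(\<lambda>n. of_int (a 0) + 1 / cf_convergent ?b n) \<longlonglongrightarrow> cf_value a"
    using LIMSEQ_Suc[OF la] by simp
  ultimately show ?thesis by (rule LIMSEQ_unique[symmetric])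
qed

section \<open>Complete quotients of an infinite continued fraction\<close>

definition complete_quotient :: "cfrac \<Rightarrow> nat \<Rightarrow> real" where
  "complete_quotient a k = cf_value (\<lambda>i. a (i + k))"

lemma complete_quotient_rec:
  assumes "infinite_cf a"
  shows "complete_quotient a k = of_int (a k) + 1 / complete_quotient a (Suc k)"
  using cf_value_rec[of "\<lambda>i. a (i + k)"] assms
  by (simp add: complete_quotient_def infinite_cf_def)

lemma complete_quotient_gt_1:
  assumes "infinite_cf a" "k \<ge> 1"
  shows "complete_quotient a k > 1"
proof -
  have ge: "complete_quotient a j \<ge> 1" if "j \<ge> 1" for j
  proof -
    have "(1::real) \<le> of_int (a j)"
      using assms(1) that by (simp add: infinite_cf_def)
    also have "\<dots> \<le> complete_quotient a j"
      using cf_value_ge[of "\<lambda>i. a (i + j)"] assms(1)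
      by (simp add: complete_quotient_def infinite_cf_def)
    finally show ?thesis .
  qed
  have "(1::real) \<le> of_int (a k)"
    using assms by (simp add: infinite_cf_def)
  moreover have "1 / complete_quotient a (Suc k) > 0"
    using ge[of "Suc k"] by simp
  ultimately show ?thesis
    using complete_quotient_rec[OF assms(1), of k] by linarith
qed

text \<open>Infinite descent along the Euclidean algorithm: if a complete quotient were
  \<open>m / n\<close>, the next one would be \<open>n / r\<close> with the remainder
  \<open>r = m - a k * n\<close>, and \<open>0 < r < n\<close> because the next one exceeds
  1.\<close>

lemma complete_quotient_irrational:
  assumes "infinite_cf a"
  shows "complete_quotient a k \<notin> \<rat>"
proof -
  have "complete_quotient a k \<noteq> of_int m / of_nat n" if "n > 0" for m :: int and n :: nat
    using that
  proof (induction n arbitrary: m k rule: less_induct)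
    case (less n)
    let ?u = "complete_quotient a (Suc k)"
    have u: "?u > 1" using complete_quotient_gt_1[OF assms, of "Suc k"] by simp
    show ?case
    proof
      assume eq: "complete_quotient a k = of_int m / of_nat n"
      define r where "r = m - a k * int n"
      have r: "of_int r = of_nat n / ?u"
        using eq complete_quotient_rec[OF assms, of k] less.prems
        by (simp add: r_def field_simps)
      have "0 < of_nat n / ?u" "of_nat n / ?u < of_nat n"
        using u less.prems by (simp_all add: field_simps)
      then have "0 < r" "r < int n"
        using r by linarith+
      moreover have "?u = of_int (int n) / of_nat (nat r)"
        using r \<open>0 < r\<close> u by (simp add: field_simps)
      moreover have "nat r < n" "nat r > 0"
        using \<open>0 < r\<close> \<open>r < int n\<close> by auto
      ultimately show False
        using less.IH[of "nat r" "Suc k" "int n"] by blast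
    qed
  qed
  then show ?thesis by (metis Rats_cases' of_int_of_nat_eq pos_int_cases)
qed

text \<open>The contraction argument again, with a convergent compared to an arbitrary sequence
  \<open>x\<close> that obeys the recursion of complete quotients.\<close>

lemma cf_convergent_approx:
  fixes x :: "nat \<Rightarrow> real"
  assumes "\<And>k. x k = of_int (a k) + 1 / x (Suc k)" "\<And>k. k \<ge> 1 \<Longrightarrow> x k \<ge> 1"
    and "\<And>k. k \<ge> 1 \<Longrightarrow> a k \<ge> 1" "n \<ge> 2 * j"
  shows "\<bar>cf_convergent a n - x 0\<bar> \<le> (1/4) ^ j"
  using assms
proof (induction j arbitrary: a x n)
  case 0
  have "x 1 \<ge> 1" using 0(2) by simp
  then have "of_int (a 0) \<le> x 0" "x 0 \<le> of_int (a 0) + 1"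
    using 0(1)[of 0] by auto
  then show ?case
    using cf_convergent_bounds[of a n, OF 0(3)] by auto
next
  case (Suc j)
  obtain n' where n: "n = Suc (Suc n')" "n' \<ge> 2 * j"
    using Suc.prems(4) by (metis add_2_eq_Suc le_Suc_ex add.assoc le_add1 mult_Suc_right)
  let ?b = "\<lambda>k. a (Suc (Suc k))" and ?y = "\<lambda>k. x (Suc (Suc k))"
  have 1: "cf_convergent ?b n' \<ge> 1"
  proof -
    have "(1::real) \<le> of_int (?b 0)" using Suc.prems(3)[of 2] by (simp add: numeral_2_eq_2)
    also have "\<dots> \<le> cf_convergent ?b n'"
      by (rule cf_convergent_bounds) (use Suc.prems(3) in auto)
    finally show ?thesis .
  qed
  have "\<bar>cf_convergent a n - x 0\<bar> \<le> \<bar>cf_convergent ?b n' - ?y 0\<bar> / 4"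
    using inverse_step_contraction[OF _ 1 _ refl, of "a 1" "?y 0" "x 1"]
      Suc.prems(3)[of 1] Suc.prems(2)[of "Suc (Suc 0)"] Suc.prems(1)[of "Suc 0"] Suc.prems(1)[of 0]
    by (simp add: n)
  also have "\<dots> \<le> (1/4) ^ j / 4"
    using Suc.IH[where x = ?y and a = ?b and n = n', OF Suc.prems(1)] Suc.prems(2,3) n(2) by simp
  finally show ?case by simp
qed

text \<open>The recursion and the lower bound 1 pin down the complete quotients. This identifies the
  value of an expansion with the number that was expanded.\<close>

lemma cf_value_eqI:
  fixes x :: "nat \<Rightarrow> real"
  assumes "\<And>k. x k = of_int (a k) + 1 / x (Suc k)" "\<And>k. k \<ge> 1 \<Longrightarrow> x k \<ge> 1"
    and "\<And>k. k \<ge> 1 \<Longrightarrow> a k \<ge> 1"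
  shows "cf_value a = x 0"
proof -
  have "cf_convergent a \<longlonglongrightarrow> x 0"
  proof (rule metric_LIMSEQ_I)
    fix e :: real assume "e > 0"
    then obtain j where "(1/4) ^ j < e"
      using real_arch_pow_inv[of e "1/4"] by auto
    then show "\<exists>N. \<forall>n\<ge>N. dist (cf_convergent a n) (x 0) < e"
      using cf_convergent_approx[of x a, OF assms(1-3)]
      by (intro exI[of _ "2 * j"]) (fastforce simp: dist_real_def)
  qed
  then show ?thesis by (simp add: cf_value_def limI)
qed

section \<open>The continued fraction algorithm\<close>

text \<open>This acts on complete quotients; the substitution of \<open>1 / x\<close> for
  \<open>x\<close> turns it into the usual Gauss map, the fractional part of the reciprocal.
  Integers are sent to 0.\<close>

definition gauss_map :: "real \<Rightarrow> real" where
  "gauss_map x = 1 / (x - of_int \<lfloor>x\<rfloor>)"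

lemma cf_expansion_eq: "cf_expansion \<alpha> k = \<lfloor>(gauss_map ^^ k) \<alpha>\<rfloor>"
  unfolding cf_expansion_def gauss_map_def[abs_def] ..

lemma gauss_map_irrational:
  assumes "x \<notin> \<rat>"
  shows "gauss_map x \<notin> \<rat>"
proof
  assume "gauss_map x \<in> \<rat>"
  then have "1 / gauss_map x + of_int \<lfloor>x\<rfloor> \<in> \<rat>" by simp
  then show False using assms by (simp add: gauss_map_def)
qed

lemma irrational_floor_less:
  fixes x :: real
  assumes "x \<notin> \<rat>"
  shows "of_int \<lfloor>x\<rfloor> < x"
  using assms of_int_floor_le[of x] by (metis Rats_of_int order_less_le)

lemma gauss_map_gt_1:
  assumes "x \<notin> \<rat>"
  shows "gauss_map x > 1"
proof -
  have "x - of_int \<lfloor>x\<rfloor> > 0" "x - of_int \<lfloor>x\<rfloor> < 1"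
    using irrational_floor_less[OF assms] by linarith+
  then show ?thesis by (simp add: gauss_map_def)
qed

text \<open>For an integer \<open>x\<close> both divisions are by 0, and the equation reads
  \<open>x = x + 0\<close>. Hence it can be applied along the orbit of a number not yet known to be
  irrational.\<close>

lemma gauss_map_rec: "x = of_int \<lfloor>x\<rfloor> + 1 / gauss_map x"
  by (simp add: gauss_map_def)

lemma gauss_map_iter_irrational: "\<alpha> \<notin> \<rat> \<Longrightarrow> (gauss_map ^^ k) \<alpha> \<notin> \<rat>"
  by (induction k) (simp_all add: gauss_map_irrational)

lemma gauss_map_iter_gt_1: "\<alpha> \<notin> \<rat> \<Longrightarrow> k \<ge> 1 \<Longrightarrow> (gauss_map ^^ k) \<alpha> > 1"
  by (cases k) (simp_all add: gauss_map_gt_1 gauss_map_iter_irrational)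

lemma infinite_cf_cf_expansion:
  assumes "\<alpha> \<notin> \<rat>"
  shows "infinite_cf (cf_expansion \<alpha>)"
  using gauss_map_iter_gt_1[OF assms]
  by (simp add: infinite_cf_def cf_expansion_eq le_floor_iff less_imp_le)

lemma cf_value_cf_expansion:
  assumes "\<alpha> \<notin> \<rat>"
  shows "cf_value (cf_expansion \<alpha>) = \<alpha>"
proof -
  have "cf_value (cf_expansion \<alpha>) = (gauss_map ^^ 0) \<alpha>"
  proof (rule cf_value_eqI)
    show "(gauss_map ^^ k) \<alpha> = of_int (cf_expansion \<alpha> k) + 1 / (gauss_map ^^ Suc k) \<alpha>" for k
      unfolding cf_expansion_eq funpow.simps comp_apply by (rule gauss_map_rec)
  qed (use gauss_map_iter_gt_1[OF assms] infinite_cf_cf_expansion[OF assms]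
       in \<open>auto simp: infinite_cf_def less_imp_le\<close>)
  then show ?thesis by simp
qed

text \<open>If all later partial quotients are at least 1, so are the iterates of
  \<open>gauss_map\<close>; then \<alpha> is the value of its own expansion, and infinite continued
  fractions have irrational values.\<close>

lemma infinite_cf_cf_expansion_irrational:
  assumes "infinite_cf (cf_expansion \<alpha>)"
  shows "\<alpha> \<notin> \<rat>"
proof
  assume "\<alpha> \<in> \<rat>"
  define x where "x k = (gauss_map ^^ k) \<alpha>" for k
  have ge: "x k \<ge> 1" if "k \<ge> 1" for k
    using assms that by (auto simp: infinite_cf_def cf_expansion_eq x_def le_floor_iff)
  have "\<alpha> = cf_value (cf_expansion \<alpha>)"
  proof -
    have "cf_value (cf_expansion \<alpha>) = x 0"
    proof (rule cf_value_eqI)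
      show "x k = of_int (cf_expansion \<alpha> k) + 1 / x (Suc k)" for k
        unfolding cf_expansion_eq x_def funpow.simps comp_apply by (rule gauss_map_rec)
    qed (use assms ge in \<open>auto simp: infinite_cf_def\<close>)
    then show ?thesis by (simp add: x_def)
  qed
  then show False
    using complete_quotient_irrational[OF assms, of 0] \<open>\<alpha> \<in> \<rat>\<close>
    by (simp add: complete_quotient_def)
qed

section \<open>Quadratic irrationals of mixed sign\<close>

text \<open>The condition \<open>A > 0 > C\<close> says that the conjugate of \<open>x\<close> is negative.\<close>

definition mixed_quadratic :: "real \<Rightarrow> bool" where
  "mixed_quadratic x \<longleftrightarrow> x \<notin> \<rat> \<and> x > 0 \<and>
     (\<exists>A B C::int. A > 0 \<and> C < 0 \<and> of_int A * x\<^sup>2 + of_int B * x + of_int C = 0)"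

lemma mixed_quadratic_mult:
  assumes "mixed_quadratic x" "q \<in> \<rat>" "q > 0"
  shows "mixed_quadratic (q * x)"
proof -
  obtain A B C :: int where ABC: "A > 0" "C < 0" "of_int A * x\<^sup>2 + of_int B * x + of_int C = 0"
    and x: "x \<notin> \<rat>" "x > 0"
    using assms(1) unfolding mixed_quadratic_def by blast
  obtain n m :: int where q: "m > 0" "q = of_int n / of_int m"
    using assms(2) by (metis Rats_cases')
  then have n: "n > 0" using assms(3) by (simp add: zero_less_divide_iff)
  have "q * x \<notin> \<rat>"
  proof
    assume "q * x \<in> \<rat>"
    then have "(q * x) / q \<in> \<rat>" using assms(2) by (rule Rats_divide)
    then show False using x assms(3) by simp
  qed
  \<comment> \<open>Replacing the variable by its quotient by \<open>q = n / m\<close> and clearing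
    denominators multiplies the outer coefficients by squares, so their signs survive.\<close>
  moreover have "of_int (A * m\<^sup>2) * (q * x)\<^sup>2 + of_int (B * n * m) * (q * x) + of_int (C * n\<^sup>2)
      = of_int n ^ 2 * (of_int A * x\<^sup>2 + of_int B * x + of_int C)"
    unfolding q(2) using q(1) by (simp add: field_simps power2_eq_square)
  moreover have "A * m\<^sup>2 > 0" "C * n\<^sup>2 < 0"
    using ABC q n by (simp_all add: mult_neg_pos)
  ultimately show ?thesis
    using x assms(3) ABC(3) unfolding mixed_quadratic_def
    by (metis mult_pos_pos mult_zero_right)
qed

text \<open>Reversing the coefficients and changing their signs swaps the roles of \<open>A\<close>
  and \<open>- C\<close>.\<close>

lemma mixed_quadratic_inverse:
  assumes "mixed_quadratic x"
  shows "mixed_quadratic (1 / x)"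
proof -
  obtain A B C :: int where ABC: "A > 0" "C < 0" "of_int A * x\<^sup>2 + of_int B * x + of_int C = 0"
    and x: "x \<notin> \<rat>" "x > 0"
    using assms(1) unfolding mixed_quadratic_def by blast
  have "1 / x \<notin> \<rat>"
    using x(1) Rats_divide[of 1 "1 / x"] by auto
  moreover have "of_int (- C) * (1 / x)\<^sup>2 + of_int (- B) * (1 / x) + of_int (- A)
      = - (of_int A * x\<^sup>2 + of_int B * x + of_int C) / x\<^sup>2"
    using x(2) by (simp add: field_simps power2_eq_square)
  ultimately show ?thesis
    using x(2) ABC unfolding mixed_quadratic_def
    by (intro conjI exI[of _ "- C"] exI[of _ "- B"] exI[of _ "- A"]) auto
qed

lemma quadratic_neg_below_root:
  fixes A B C d x :: real
  assumes "A > 0" "C < 0" "A * x\<^sup>2 + B * x + C = 0" "0 \<le> d" "d < x"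
  shows "A * d\<^sup>2 + B * d + C < 0"
proof -
  \<comment> \<open>For \<open>f\<close> the polynomial, \<open>x * f d - d * f x\<close> is
    divisible by \<open>d - x\<close>; this gives the sign of \<open>f d\<close> without mentioning
    the second root.\<close>
  have "x * (A * d\<^sup>2 + B * d + C) = (d - x) * (A * d * x - C) + d * (A * x\<^sup>2 + B * x + C)"
    by (simp add: algebra_simps power2_eq_square)
  also have "\<dots> = (d - x) * (A * d * x - C)" by (simp add: assms(3))
  also have "\<dots> < 0"
  proof (rule mult_neg_pos)
    have "A * d * x \<ge> 0" using assms by simp
    then show "A * d * x - C > 0" using assms(2) by linarith
  qed (use assms in simp)
  finally show ?thesis
    using assms(4,5) by (simp add: mult_less_0_iff)
qed

text \<open>The shifted polynomial keeps its leading coefficient, and its constant term is the value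
  of the old one at \<open>d\<close>, negative because \<open>d\<close> lies in
  \<open>[0, x)\<close>.\<close>

lemma mixed_quadratic_diff:
  fixes x :: real and d :: int
  assumes "mixed_quadratic x" "d \<ge> 0" "d < x"
  shows "mixed_quadratic (x - d)"
proof -
  obtain A B C :: int where ABC: "A > 0" "C < 0" "of_int A * x\<^sup>2 + of_int B * x + of_int C = 0"
    and x: "x \<notin> \<rat>" "x > 0"
    using assms(1) unfolding mixed_quadratic_def by blast
  have "x - d \<notin> \<rat>"
    using x(1) Rats_add[of "x - d" d] by auto
  moreover have "of_int (A * d\<^sup>2 + B * d + C) < (0::real)"
    using quadratic_neg_below_root[of A C x B d] ABC assms by simp
  then have "A * d\<^sup>2 + B * d + C < 0" by (simp only: of_int_less_0_iff)
  moreover have "of_int A * (x - d)\<^sup>2 + of_int (2 * A * d + B) * (x - d) + of_int (A * d\<^sup>2 + B * d + C) = 0"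
    using ABC(3) by (simp add: algebra_simps power2_eq_square)
  ultimately show ?thesis
    using assms(3) ABC(1) unfolding mixed_quadratic_def by (metis diff_gt_0_iff_gt)
qed

section \<open>Essentially periodic expansions have mixed quadratic values\<close>

text \<open>The integers are the entries of a product of matrices with rows \<open>(c, 1)\<close>
  and \<open>(1, 0)\<close>, one for each partial quotient \<open>c\<close>. At least one factor is
  taken, since the identity matrix would have \<open>q = r = 0\<close>; a single factor has
  \<open>t = 0\<close>.\<close>

lemma complete_quotient_moebius:
  assumes "infinite_cf a" "k \<ge> 1"
  shows "\<exists>p q r t::int. p > 0 \<and> q > 0 \<and> r > 0 \<and> t \<ge> 0 \<and>
    complete_quotient a k * (of_int r * complete_quotient a (k + Suc n) + of_int t)
      = of_int p * complete_quotient a (k + Suc n) + of_int q"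
proof (induction n)
  case 0
  have "a k > 0" using assms by (simp add: infinite_cf_def order_less_le_trans[OF zero_less_one])
  moreover have "complete_quotient a k * complete_quotient a (Suc k)
      = of_int (a k) * complete_quotient a (Suc k) + 1"
    using complete_quotient_rec[OF assms(1), of k] complete_quotient_gt_1[OF assms(1), of "Suc k"]
    by (simp add: field_simps)
  ultimately show ?case
    by (intro exI[of _ "a k"] exI[of _ 1] exI[of _ 0]) simp
next
  case (Suc n)
  define y where "y = complete_quotient a (k + Suc n)"
  define z where "z = complete_quotient a (k + Suc (Suc n))"
  define c where "c = a (k + Suc n)"
  obtain p q r t :: int where pos: "p > 0" "q > 0" "r > 0" "t \<ge> 0"
    and eq: "complete_quotient a k * (of_int r * y + of_int t) = of_int p * y + of_int q"
    using Suc unfolding y_def by blast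
  have c: "c > 0" using assms by (simp add: infinite_cf_def c_def order_less_le_trans[OF zero_less_one])
  have z: "z > 1" using complete_quotient_gt_1[OF assms(1)] by (simp add: z_def)
  have yz: "y * z = of_int c * z + 1"
    using complete_quotient_rec[OF assms(1), of "k + Suc n"] z
    by (simp add: y_def z_def c_def field_simps)
  have "complete_quotient a k * (of_int (r * c + t) * z + of_int r)
      = complete_quotient a k * (of_int r * (y * z) + of_int t * z)"
    by (simp add: yz algebra_simps)
  also have "\<dots> = (complete_quotient a k * (of_int r * y + of_int t)) * z"
    by (simp add: algebra_simps)
  also have "\<dots> = of_int p * (y * z) + of_int q * z"
    unfolding eq by (simp add: algebra_simps)
  also have "\<dots> = of_int (p * c + q) * z + of_int p"
    by (simp add: yz algebra_simps)
  finally show ?case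
    using pos c unfolding z_def
    by (intro exI[of _ "p * c + q"] exI[of _ p] exI[of _ "r * c + t"] exI[of _ r])
      (simp add: add_pos_nonneg)
qed

text \<open>A fixed point \<open>w\<close> of the Moebius map is a root of the polynomial with
  coefficients \<open>r\<close>, \<open>t - p\<close>, \<open>- q\<close>, whose outer signs are
  right because \<open>r\<close> and \<open>q\<close> are positive.\<close>

lemma mixed_quadratic_purely_periodic:
  assumes "infinite_cf a" "k \<ge> 1" "s \<ge> 1" "complete_quotient a (k + s) = complete_quotient a k"
  shows "mixed_quadratic (complete_quotient a k)"
proof -
  define w where "w = complete_quotient a k"
  have "complete_quotient a (k + Suc (s - 1)) = w"
    using assms(3,4) by (simp add: w_def)
  then obtain p q r t :: int where "q > 0" "r > 0"
    and "w * (of_int r * w + of_int t) = of_int p * w + of_int q"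
    using complete_quotient_moebius[OF assms(1,2), of "s - 1"] unfolding w_def by metis
  then have "r > 0 \<and> - q < 0 \<and> of_int r * w\<^sup>2 + of_int (t - p) * w + of_int (- q) = 0"
    by (simp add: algebra_simps power2_eq_square)
  then show ?thesis
    using complete_quotient_irrational[OF assms(1)] complete_quotient_gt_1[OF assms(1,2)]
    unfolding mixed_quadratic_def w_def by (metis less_trans zero_less_one)
qed

text \<open>The complete quotients 0 and \<open>s\<close> have the same tail after their leading
  terms, so they differ by \<open>a s - a 0\<close>. The latter one is purely periodic, and
  \<open>a 0 \<le> a s\<close> makes the shift nonnegative.\<close>

lemma mixed_quadratic_periodic_tail:
  assumes a: "infinite_cf a" and s: "s \<ge> 1" and per: "\<And>k. k \<ge> 1 \<Longrightarrow> a (k + s) = a k"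
    and le: "a 0 \<le> a s" and pos: "cf_value a > 0"
  shows "mixed_quadratic (cf_value a)"
proof -
  let ?v = "complete_quotient a"
  have shift: "?v (k + s) = ?v k" if "k \<ge> 1" for k
  proof -
    have "a (i + (k + s)) = a (i + k)" for i
      using per[of "i + k"] that by (simp add: add.assoc)
    then show ?thesis by (simp add: complete_quotient_def)
  qed
  have "?v s = of_int (a s) + 1 / ?v 1"
    using complete_quotient_rec[OF a, of s] shift[of 1] by simp
  moreover have v0: "?v 0 = of_int (a 0) + 1 / ?v 1"
    using complete_quotient_rec[OF a, of 0] by simp
  moreover have "?v 0 = cf_value a" by (simp add: complete_quotient_def)
  ultimately have eq: "cf_value a = ?v s - of_int (a s - a 0)" by simp
  have "mixed_quadratic (?v s)"
    using mixed_quadratic_purely_periodic[OF a s s] shift[OF s] by simp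
  then show ?thesis
    using mixed_quadratic_diff[of "?v s" "a s - a 0"] le pos by (simp add: eq)
qed

lemma mixed_quadratic_ESP_plus:
  assumes "a \<in> ESP_plus"
  shows "mixed_quadratic (cf_value a)"
proof -
  have inf: "infinite_cf a" and pos: "cf_value a > 0"
    using assms by (auto simp: ESP_plus_def essentially_periodic_def)
  from assms consider
    s where "s \<ge> 1" "\<forall>k\<ge>1. a (k + s) = a k" "a 0 \<le> a s"
    | s where "s \<ge> 1" "a 0 = 0" "\<forall>k\<ge>2. a (k + s) = a k" "a 1 \<le> a (s + 1)"
    by (auto simp: ESP_plus_def essentially_periodic_def)
  then show ?thesis
  proof cases
    case 1
    then show ?thesis using mixed_quadratic_periodic_tail[OF inf _ _ _ pos] by auto
  next
    case (2 s)
    let ?b = "\<lambda>k. a (Suc k)"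
    \<comment> \<open>With \<open>a 0 = 0\<close>, the second shape is the reciprocal of the first
      one: for \<open>?b\<close>, the condition on \<open>a 1\<close> and \<open>a (s + 1)\<close>
      compares the entries 0 and \<open>s\<close>.\<close>
    have rec: "cf_value a = 1 / cf_value ?b"
      using cf_value_rec[of a] inf 2(2) by (simp add: infinite_cf_def)
    have "mixed_quadratic (cf_value ?b)"
    proof (rule mixed_quadratic_periodic_tail)
      show "infinite_cf ?b" using inf by (simp add: infinite_cf_def)
      show "?b (k + s) = ?b k" if "k \<ge> 1" for k
        using 2(3)[rule_format, of "Suc k"] that by simp
      show "cf_value ?b > 0" using rec pos by simp
    qed (use 2 in auto)
    then show ?thesis using rec mixed_quadratic_inverse by simp
  qed
qed

section \<open>Mixed quadratic irrationals have essentially periodic expansions\<close>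

text \<open>The polynomial enters through Vieta's formulas. Its coefficients stay hidden and need
  not be coprime; \<open>D\<close> is a parameter because it is the invariant of the
  algorithm.\<close>

definition conj_pair :: "int \<Rightarrow> real \<times> real \<Rightarrow> bool" where
  "conj_pair D z \<longleftrightarrow> fst z \<notin> \<rat> \<and> fst z > 0 \<and> snd z < 0 \<and>
     (\<exists>A B C::int. A > 0 \<and> C < 0 \<and> B\<^sup>2 - 4 * A * C = D \<and>
        of_int A * (fst z + snd z) = - of_int B \<and> of_int A * (fst z * snd z) = of_int C)"

text \<open>Both components use the floor of the first, so that conjugates undergo the same Moebius
  map.\<close>

definition pair_step :: "real \<times> real \<Rightarrow> real \<times> real" where
  "pair_step z = (1 / (fst z - of_int \<lfloor>fst z\<rfloor>), 1 / (snd z - of_int \<lfloor>fst z\<rfloor>))"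

lemma mixed_quadratic_conj_pair:
  assumes "mixed_quadratic x"
  shows "\<exists>D y. conj_pair D (x, y)"
proof -
  obtain A B C :: int where ABC: "A > 0" "C < 0" "of_int A * x\<^sup>2 + of_int B * x + of_int C = 0"
    and x: "x \<notin> \<rat>" "x > 0"
    using assms(1) unfolding mixed_quadratic_def by blast
  define y where "y = of_int C / (of_int A * x)"
  have "of_int A * (x + y) = (of_int A * x\<^sup>2 + of_int C) / x"
    using ABC x by (simp add: y_def field_simps power2_eq_square)
  also have "of_int A * x\<^sup>2 + of_int C = - of_int B * x"
    using ABC(3) by simp
  finally have "of_int A * (x + y) = - of_int B" using x by simp
  moreover have "of_int A * (x * y) = of_int C" using ABC x by (simp add: y_def)
  moreover have "y < 0" using ABC x by (simp add: y_def divide_less_0_iff)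
  ultimately have "conj_pair (B\<^sup>2 - 4 * A * C) (x, y)"
    using x ABC by (auto simp: conj_pair_def)
  then show ?thesis by blast
qed

text \<open>Substituting \<open>n + 1 / X\<close> for the variable, clearing denominators and
  changing sign yields the coefficients \<open>- f\<close>, \<open>- (B + 2 * n * A)\<close>,
  \<open>- A\<close>, with the same discriminant. Here \<open>f\<close> is the value at
  \<open>n\<close>, negative because \<open>n\<close> lies between \<open>y\<close> and
  \<open>x\<close>.\<close>

lemma conj_pair_step:
  assumes "conj_pair D z"
  shows "conj_pair D (pair_step z)"
proof -
  obtain x y where z: "z = (x, y)" by fastforce
  obtain A B C :: int where ABC: "A > 0" "C < 0" "B\<^sup>2 - 4 * A * C = D"
    "of_int A * (x + y) = - of_int B" "of_int A * (x * y) = of_int C"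
    and x: "x \<notin> \<rat>" "x > 0" and y: "y < 0"
    using assms unfolding conj_pair_def z by auto
  define n where "n = \<lfloor>x\<rfloor>"
  define f where "f = A * n\<^sup>2 + B * n + C"
  have n: "n \<ge> 0" using x by (simp add: n_def)
  have xn: "x - of_int n > 0" using irrational_floor_less[OF x(1)] by (simp add: n_def)
  have yn: "y - of_int n < 0" using y n by linarith
  have "of_int A * ((x - of_int n) * (y - of_int n))
      = of_int A * (x * y) - of_int n * (of_int A * (x + y)) + of_int A * (of_int n)\<^sup>2"
    by (simp add: algebra_simps power2_eq_square)
  also have "\<dots> = of_int f"
    unfolding ABC(4,5) f_def by (simp add: algebra_simps)
  finally have prod: "of_int A * ((x - of_int n) * (y - of_int n)) = of_int f" .
  have sum: "of_int A * ((x - of_int n) + (y - of_int n)) = - of_int (B + 2 * n * A)"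
    using ABC(4) by (simp add: algebra_simps)
  have "of_int f < (0::real)"
    unfolding prod[symmetric] using ABC(1) xn yn by (simp add: mult_pos_neg)
  then have f: "f < 0" by simp
  define u v where "u = 1 / (x - of_int n)" and "v = 1 / (y - of_int n)"
  have "p * q * (1 / p + 1 / q) = p + q" if "p > 0" "q < 0" for p q :: real
    using that by (simp add: field_simps)
  from this[OF xn yn] have "of_int (- f) * (u + v) = - (of_int A * ((x - of_int n) + (y - of_int n)))"
    unfolding u_def v_def of_int_minus prod[symmetric] by (simp only: mult.assoc mult_minus_left)
  then have sum': "of_int (- f) * (u + v) = - of_int (- (B + 2 * n * A))"
    unfolding sum by simp
  have prod': "of_int (- f) * (u * v) = of_int (- A)"
    unfolding u_def v_def of_int_minus prod[symmetric] using xn yn by simp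
  have disc: "(- (B + 2 * n * A))\<^sup>2 - 4 * (- f) * (- A) = D"
    unfolding ABC(3)[symmetric] f_def by (simp add: algebra_simps power2_eq_square)
  have "u = gauss_map x" by (simp add: u_def n_def gauss_map_def)
  then have "u \<notin> \<rat>" using gauss_map_irrational[OF x(1)] by simp
  moreover have "u > 0" "v < 0" using xn yn by (simp_all add: u_def v_def)
  moreover have "- f > 0" "- A < 0" using f ABC(1) by simp_all
  ultimately have "conj_pair D (u, v)"
    using sum' prod' disc unfolding conj_pair_def fst_conv snd_conv by blast
  then show ?thesis by (simp add: pair_step_def z u_def v_def n_def)
qed

text \<open>As \<open>A * (- C)\<close> is positive, \<open>D\<close> is a sum of nonnegative terms
  that bounds \<open>A\<close> and \<open>B\<close>, and the quadratic formula recovers the pair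
  from \<open>A\<close>, \<open>B\<close> and \<open>D\<close>.\<close>

lemma finite_conj_pair: "finite {z. conj_pair D z}"
proof (rule finite_subset)
  let ?g = "\<lambda>(A::int, B::int). ((- of_int B + sqrt (of_int D)) / (2 * of_int A),
                                (- of_int B - sqrt (of_int D)) / (2 * of_int A))"
  show "finite (?g ` ({1..D} \<times> {-D..D}))" by simp
  show "{z. conj_pair D z} \<subseteq> ?g ` ({1..D} \<times> {-D..D})"
  proof
    fix z assume "z \<in> {z. conj_pair D z}"
    then obtain x y where z: "z = (x, y)" and c: "conj_pair D (x, y)" by (cases z) auto
    obtain A B C :: int where ABC: "A > 0" "C < 0" "B\<^sup>2 - 4 * A * C = D"
      "of_int A * (x + y) = - of_int B" "of_int A * (x * y) = of_int C"
      and x: "x > 0" and y: "y < 0"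
      using c unfolding conj_pair_def by auto
    have "A * 1 \<le> A * (- C)" using ABC by (intro mult_left_mono) auto
    moreover have D: "D = B\<^sup>2 + 4 * (A * (- C))" using ABC(3) by simp
    ultimately have "A \<le> D" "B\<^sup>2 \<le> D" using ABC(1) zero_le_power2[of B] by linarith+
    moreover have "\<bar>B\<bar> \<le> B\<^sup>2"
    proof (cases "B = 0")
      case False
      then have "\<bar>B\<bar> * 1 \<le> \<bar>B\<bar> * \<bar>B\<bar>" by (intro mult_left_mono) auto
      then show ?thesis by (simp add: power2_eq_square)
    qed simp
    ultimately have "(A, B) \<in> {1..D} \<times> {-D..D}" using ABC(1) by auto
    moreover have "of_int D = (of_int A * (x - y))\<^sup>2"
    proof -
      have "of_int D = (- of_int B)\<^sup>2 - 4 * of_int A * (of_int C :: real)"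
        using ABC(3) by force
      also have "\<dots> = (of_int A * (x - y))\<^sup>2"
        unfolding ABC(4,5)[symmetric] by (simp add: algebra_simps power2_eq_square)
      finally show ?thesis .
    qed
    \<comment> \<open>The order \<open>y < 0 < x\<close> decides the sign of the root, so
      \<open>x\<close> takes the plus sign.\<close>
    then have "sqrt (of_int D) = of_int A * (x - y)"
      using ABC(1) x y by (simp add: real_sqrt_mult)
    then have "?g (A, B) = (x, y)"
      unfolding case_prod_conv ABC(4)[symmetric] using ABC(1) by (simp add: field_simps)
    ultimately show "z \<in> ?g ` ({1..D} \<times> {-D..D})" unfolding z by (intro image_eqI[of _ ?g "(A, B)"]) simp_all
  qed
qed

lemma fst_pair_step_iter: "fst ((pair_step ^^ k) z) = (gauss_map ^^ k) (fst z)"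
  by (induction k) (auto simp: pair_step_def gauss_map_def)

text \<open>The new second component is minus the reciprocal of the difference in the hypothesis.
  Given \<open>snd z < 0\<close>, that difference exceeds 1 as soon as the floor is at least 1; for
  floor 0 it does so only if \<open>snd z < - 1\<close>.\<close>

lemma snd_pair_step:
  assumes "snd z < 0" "of_int \<lfloor>fst z\<rfloor> - snd z > 1"
  shows "- 1 < snd (pair_step z)" "snd (pair_step z) < 0"
proof -
  define d where "d = of_int \<lfloor>fst z\<rfloor> - snd z"
  have "snd (pair_step z) = - (1 / d)"
    unfolding d_def minus_divide_right by (simp add: pair_step_def)
  then show "- 1 < snd (pair_step z)" "snd (pair_step z) < 0"
    using assms(2) by (simp_all add: d_def)
qed

text \<open>Equal images have equal second components minus floors. For floor \<open>n\<close> such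
  a difference lies strictly between \<open>- n - 1\<close> and \<open>- n\<close>, and these
  intervals are disjoint.\<close>

lemma inj_on_pair_step:
  "inj_on pair_step {z. - 1 < snd z \<and> snd z < 0}"
proof (rule inj_onI)
  fix z w assume z: "z \<in> {z. - 1 < snd z \<and> snd z < 0}" and w: "w \<in> {z. - 1 < snd z \<and> snd z < 0}"
    and eq: "pair_step z = pair_step w"
  have 1: "fst z - of_int \<lfloor>fst z\<rfloor> = fst w - of_int \<lfloor>fst w\<rfloor>"
    and 2: "snd z - of_int \<lfloor>fst z\<rfloor> = snd w - of_int \<lfloor>fst w\<rfloor>"
    using eq by (auto simp: pair_step_def)
  have "\<lfloor>fst z\<rfloor> = \<lfloor>fst w\<rfloor>" using 2 z w by auto
  then show "z = w" using 1 2 by (simp add: prod_eq_iff)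
qed

lemma periodic_tail_conj_pair:
  assumes c: "conj_pair D (x, y)" and gt: "of_int \<lfloor>x\<rfloor> - y > 1"
  shows "\<exists>s\<ge>1. (\<forall>k\<ge>1. cf_expansion x (k + s) = cf_expansion x k) \<and>
           cf_expansion x 0 \<le> cf_expansion x s"
proof -
  define z where "z k = (pair_step ^^ k) (x, y)" for k
  have cz: "conj_pair D (z k)" for k
    by (induction k) (simp_all add: z_def c conj_pair_step)
  have z_Suc: "z (Suc k) = pair_step (z k)" for k by (simp add: z_def)
  have fz: "fst (z k) = (gauss_map ^^ k) x" for k by (simp add: z_def fst_pair_step_iter)
  have cf: "cf_expansion x k = \<lfloor>fst (z k)\<rfloor>" for k by (simp add: fz cf_expansion_eq)
  have irr: "x \<notin> \<rat>" using c by (simp add: conj_pair_def)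
  have neg: "snd (z k) < 0" for k using cz by (simp add: conj_pair_def)
  have red: "z k \<in> {z. - 1 < snd z \<and> snd z < 0}" if k: "k \<ge> 1" for k
  proof -
    obtain j where j: "k = Suc j" using k by (cases k) auto
    have "of_int \<lfloor>fst (z j)\<rfloor> - snd (z j) > 1"
    proof (cases "j = 0")
      case True
      then show ?thesis using gt by (simp add: z_def)
    next
      case False
      then have "fst (z j) > 1" using gauss_map_iter_gt_1[OF irr] by (simp add: fz)
      then have "\<lfloor>fst (z j)\<rfloor> \<ge> 1" by (simp add: le_floor_iff)
      then show ?thesis using neg[of j] by linarith
    qed
    then show ?thesis using snd_pair_step[OF neg] by (simp add: j z_Suc)
  qed
  have "\<not> inj z"
  proof
    assume "inj z"
    moreover have "finite (range z)"
      using finite_subset[OF _ finite_conj_pair[of D]] cz by blast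
    ultimately show False using finite_imageD infinite_UNIV_nat by blast
  qed
  then obtain i j where ij: "i < j" "z i = z j"
    unfolding inj_def by (metis linorder_neqE_nat)
  define s where "s = j - i"
  have s: "s \<ge> 1" "z i = z (i + s)" using ij by (simp_all add: s_def)
  \<comment> \<open>Moving on to \<open>Suc i\<close> keeps every index of the following backward
    induction at least 1, where \<open>pair_step\<close> is injective.\<close>
  have "z (Suc i) = z (Suc i + s)" using s(2) by (simp add: z_Suc)
  then have z1: "z 1 = z (1 + s)"
  proof (induction i)
    case (Suc i)
    then have "pair_step (z (Suc i)) = pair_step (z (Suc i + s))" by (simp add: z_Suc)
    then have "z (Suc i) = z (Suc i + s)"
      using inj_onD[OF inj_on_pair_step] red by simp
    then show ?case by (rule Suc.IH)
  qed simp
  have per: "z (k + s) = z k" if "k \<ge> 1" for k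
    using that by (induction k rule: dec_induct) (use z1 in \<open>simp_all add: z_Suc\<close>)
  \<comment> \<open>The pair \<open>z 0\<close> may lie outside the region of injectivity, so only
    the images are known to agree. The floor of \<open>fst (z 0)\<close> minus that of
    \<open>fst (z s)\<close> is then \<open>snd (z 0) - snd (z s)\<close>, which is below 1 as
    \<open>snd (z 0) < 0\<close> and \<open>snd (z s) > - 1\<close>; being an integer, it is at most
    0.\<close>
  have "pair_step (z 0) = pair_step (z s)" using z1 by (simp add: z_Suc)
  then have "snd (z 0) - of_int \<lfloor>fst (z 0)\<rfloor> = snd (z s) - of_int \<lfloor>fst (z s)\<rfloor>"
    by (simp add: pair_step_def)
  then have "\<lfloor>fst (z 0)\<rfloor> \<le> \<lfloor>fst (z s)\<rfloor>"
    using neg[of 0] red[OF s(1)] by auto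
  then show ?thesis unfolding cf using s(1) per by (intro exI[of _ s]) simp
qed

lemma cf_expansion_in_ESP_plus:
  assumes "mixed_quadratic x"
  shows "cf_expansion x \<in> ESP_plus"
proof -
  have x: "x \<notin> \<rat>" "x > 0" using assms by (auto simp: mixed_quadratic_def)
  obtain D y where c: "conj_pair D (x, y)"
    using mixed_quadratic_conj_pair[OF assms] by blast
  have y: "y < 0" using c by (simp add: conj_pair_def)
  have "(\<exists>s\<ge>1. (\<forall>k\<ge>1. cf_expansion x (k + s) = cf_expansion x k) \<and>
             cf_expansion x 0 \<le> cf_expansion x s) \<or>
      (\<exists>s\<ge>1. cf_expansion x 0 = 0 \<and> (\<forall>k\<ge>2. cf_expansion x (k + s) = cf_expansion x k) \<and>
             cf_expansion x 1 \<le> cf_expansion x (s + 1))"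
  proof (cases "of_int \<lfloor>x\<rfloor> - y > 1")
    case True
    then show ?thesis using periodic_tail_conj_pair[OF c] by blast
  next
    case False
    \<comment> \<open>Here the expansion starts with 0. After one step the floor is at least 1, so
      the periodicity result applies to the image and yields the second shape, with indices moved by
      one.\<close>
    have x0: "\<lfloor>x\<rfloor> = 0" using False x(2) y by linarith
    define u v where "u = fst (pair_step (x, y))" and "v = snd (pair_step (x, y))"
    have c': "conj_pair D (u, v)" using conj_pair_step[OF c] by (simp add: u_def v_def)
    have u: "u = gauss_map x" by (simp add: u_def pair_step_def gauss_map_def)
    have "\<lfloor>u\<rfloor> \<ge> 1" using gauss_map_gt_1[OF x(1)] by (simp add: u le_floor_iff)
    moreover have "v < 0" using c' by (simp add: conj_pair_def)
    ultimately have "of_int \<lfloor>u\<rfloor> - v > 1" by linarith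
    then obtain s where s: "s \<ge> 1" "\<forall>k\<ge>1. cf_expansion u (k + s) = cf_expansion u k"
      "cf_expansion u 0 \<le> cf_expansion u s"
      using periodic_tail_conj_pair[OF c'] by blast
    have shift: "cf_expansion x (Suc k) = cf_expansion u k" for k
      by (simp add: cf_expansion_eq u funpow_swap1)
    have "cf_expansion x (k + s) = cf_expansion x k" if k: "k \<ge> 2" for k
    proof -
      obtain j where "k = Suc j" "j \<ge> 1" using k by (cases k) auto
      then show ?thesis using s(2) shift by simp
    qed
    moreover have "cf_expansion x 0 = 0" using x0 by (simp add: cf_expansion_eq)
    moreover have "cf_expansion x 1 \<le> cf_expansion x (s + 1)"
      using s(3) shift[of 0] shift[of s] by simp
    ultimately show ?thesis using s(1) by blast
  qed
  then show ?thesis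
    using infinite_cf_cf_expansion[OF x(1)] cf_value_cf_expansion[OF x(1)] x(2)
    by (simp add: ESP_plus_def essentially_periodic_def)
qed

theorem corollary3p5:
  "(\<forall>n::nat. n \<ge> 1 \<longrightarrow> cf_mult n ` ESP_plus \<subseteq> ESP_plus) \<and>
   (\<forall>q::real. q \<in> \<rat> \<and> q > 0 \<longrightarrow>
      (\<forall>\<alpha>::real. cf_expansion \<alpha> \<in> ESP_plus \<longrightarrow> cf_expansion (q * \<alpha>) \<in> ESP_plus))"
proof (intro conjI allI impI)
  fix n :: nat assume "n \<ge> 1"
  then show "cf_mult n ` ESP_plus \<subseteq> ESP_plus"
    using cf_expansion_in_ESP_plus mixed_quadratic_mult mixed_quadratic_ESP_plus
    by (auto simp: cf_mult_def)
next
  fix q \<alpha> :: real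
  assume q: "q \<in> \<rat> \<and> q > 0" and \<alpha>: "cf_expansion \<alpha> \<in> ESP_plus"
  \<comment> \<open>Only the expansion of \<alpha> is given; irrationality makes \<alpha> the value
    of that expansion.\<close>
  then have "\<alpha> \<notin> \<rat>"
    by (intro infinite_cf_cf_expansion_irrational) (simp add: ESP_plus_def essentially_periodic_def)
  then have "mixed_quadratic \<alpha>"
    using mixed_quadratic_ESP_plus[OF \<alpha>] cf_value_cf_expansion by simp
  then show "cf_expansion (q * \<alpha>) \<in> ESP_plus"
    using cf_expansion_in_ESP_plus mixed_quadratic_mult q by blast
qed

end
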